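(* Let $n\ge 1$, write $n=3q+r$ with $q,r$ integers, $0\le r<3$, let $s$ be the word $12\dots n$, and let $W^n$ be a word of minimal length among the words over $[n]$ fixing all $n$-component monotone networks. Then the word \[ \tilde W^n:=q\cdot(s\,s\,W^n),\ r\cdot s \] fixes every $n$-component balanced network. Therefore \[ \lambda_M(n)\ \le\ \lambda_B(n)\ \le\ \frac n3\,\lambda_M(n)+n^2 . \]
   Context: An $n$-component (Boolean) network is a function $f=(f_1,\dots,f_n):\{0,1\}^n\to\{0,1\}^n$. Write $[n]=\{1,\dots,n\}$. For $i\in[n]$, $f^i(x):=(x_1,\dots,x_{i-1},f_i(x),x_{i+1},\dots,x_n)$, and for a word $w=i_1\dots i_k$ over $[n]$, $f^w:=f^{i_k}\circ\cdots\circ f^{i_1}$ (identity for the empty word). A word $w$ fixes $f$ if $f^w(x)$ is a fixed point of $f$ for every $x$. For a word $u$ and integer $k\ge0$, $k\cdot u$ denotes $u$ repeated $k$ times (empty word if $k=0$); juxtaposition and commas denote concatenation. $f$ is monotone if $x\le y$ (componentwise) implies $f(x)\le f(y)$. The interaction graph of $f$ is the directed graph on $[n]$ (loops allowed) with an edge from $j$ to $i$ iff there exist $x,y$ differing only in component $j$ with $f_i(x)\ne f_i(y)$. In the signed interaction graph, each such edge $ji$ gets the sign $\sigma(ji)=1$ if $f_i(x)\le f_i(x+e_j)$ for all $x$ with $x_j=0$; $\sigma(ji)=-1$ if $f_i(x)\ge f_i(x+e_j)$ for all $x$ with $x_j=0$; and $\sigma(ji)=0$ otherwise (here $e_j$ is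 the $j$-th unit vector and addition is modulo two). The sign of a (directed, without repeated vertices) cycle is the product of the signs of its edges. $f$ is balanced if all cycles of its signed interaction graph have sign $1$. $\lambda_M(n)$ (resp. $\lambda_B(n)$) is the minimum length of a single word over $[n]$ fixing all $n$-component monotone (resp. balanced) networks. (It is known that some word fixes all $n$-component monotone networks.) *)

theory Defs
  imports Complex_Main "HOL-Library.FuncSet" "Graph_Theory.Pair_Digraph"
begin

text \<open>
  A point of the cube over the components \<open>1, \<dots>, n\<close> is a Boolean function on the naturals that
  is \<open>undefined\<close> outside \<open>{1..n}\<close>, so that equality of points is equality of functions;
  \<^const>\<open>False\<close> and \<^const>\<open>True\<close> play the roles of 0 and 1, ordered by \<open>False \<le> True\<close>.
  The behaviour of a network outside the cube is irrelevant to everything below.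
\<close>

definition cube :: "nat \<Rightarrow> (nat \<Rightarrow> bool) set" where
  "cube n = {1..n} \<rightarrow>\<^sub>E UNIV"

type_synonym network = "(nat \<Rightarrow> bool) \<Rightarrow> (nat \<Rightarrow> bool)"

definition is_network :: "nat \<Rightarrow> network \<Rightarrow> bool" where
  "is_network n f \<longleftrightarrow> f \<in> cube n \<rightarrow> cube n"

definition update :: "network \<Rightarrow> nat \<Rightarrow> (nat \<Rightarrow> bool) \<Rightarrow> (nat \<Rightarrow> bool)" where
  "update f i x = x(i := f x i)"

text \<open>The leftmost letter of the word is applied first.\<close>

definition update_word :: "network \<Rightarrow> nat list \<Rightarrow> (nat \<Rightarrow> bool) \<Rightarrow> (nat \<Rightarrow> bool)" where
  "update_word f w = fold (update f) w"

definition word_fixes :: "nat \<Rightarrow> nat list \<Rightarrow> network \<Rightarrow> bool" where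
  "word_fixes n w f \<longleftrightarrow> (\<forall>x\<in>cube n. f (update_word f w x) = update_word f w x)"

definition monotone_network :: "nat \<Rightarrow> network \<Rightarrow> bool" where
  "monotone_network n f \<longleftrightarrow> is_network n f \<and>
     (\<forall>x\<in>cube n. \<forall>y\<in>cube n. (\<forall>i\<in>{1..n}. x i \<le> y i) \<longrightarrow> (\<forall>i\<in>{1..n}. f x i \<le> f y i))"

text \<open>The pair \<open>(j, i)\<close> is the arc from \<open>j\<close> to \<open>i\<close>.\<close>

definition interaction_graph :: "nat \<Rightarrow> network \<Rightarrow> nat pair_pre_digraph" where
  "interaction_graph n f =
     \<lparr> pverts = {1..n},
       parcs = {(j, i). j \<in> {1..n} \<and> i \<in> {1..n} \<and>
         (\<exists>x\<in>cube n. \<exists>y\<in>cube n. {k \<in> {1..n}. x k \<noteq> y k} = {j} \<and> f x i \<noteq> f y i)} \<rparr>"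

definition arc_sign :: "nat \<Rightarrow> network \<Rightarrow> nat \<times> nat \<Rightarrow> int" where
  "arc_sign n f = (\<lambda>(j, i).
     if \<forall>x\<in>cube n. \<not> x j \<longrightarrow> f x i \<le> f (x(j := True)) i then 1
     else if \<forall>x\<in>cube n. \<not> x j \<longrightarrow> f x i \<ge> f (x(j := True)) i then -1
     else 0)"

text \<open>
  \<^const>\<open>pre_digraph.cycle\<close> describes a cycle by its list of arcs; it requires pairwise distinct
  vertices and admits loops.
\<close>

definition balanced_network :: "nat \<Rightarrow> network \<Rightarrow> bool" where
  "balanced_network n f \<longleftrightarrow> is_network n f \<and>
     (\<forall>c. pre_digraph.cycle (with_proj (interaction_graph n f)) c \<longrightarrow>
        prod_list (map (arc_sign n f) c) = 1)"

definition fixes_all :: "nat \<Rightarrow> (nat \<Rightarrow> network \<Rightarrow> bool) \<Rightarrow> nat list \<Rightarrow> bool" where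
  "fixes_all n P w \<longleftrightarrow> w \<in> lists {1..n} \<and> (\<forall>f. P n f \<longrightarrow> word_fixes n w f)"

definition min_fixing_length :: "(nat \<Rightarrow> network \<Rightarrow> bool) \<Rightarrow> nat \<Rightarrow> nat" where
  "min_fixing_length P n = (LEAST k. \<exists>w. fixes_all n P w \<and> length w = k)"

definition lambda_M :: "nat \<Rightarrow> nat" where
  "lambda_M = min_fixing_length monotone_network"

definition lambda_B :: "nat \<Rightarrow> nat" where
  "lambda_B = min_fixing_length balanced_network"

definition word_power :: "nat \<Rightarrow> 'a list \<Rightarrow> 'a list" where
  "word_power k u = concat (replicate k u)"

definition word_s :: "nat \<Rightarrow> nat list" where
  "word_s n = [1..<Suc n]"

definition word_tilde :: "nat \<Rightarrow> nat \<Rightarrow> nat \<Rightarrow> nat list \<Rightarrow> nat list" where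
  "word_tilde n q r W = word_power q (word_s n @ word_s n @ W) @ word_power r (word_s n)"

end

theory Submission
  imports Defs
begin

text \<open>
  In a balanced network the signs along each strong component come from a potential, so after
  negating some components the dynamics inside a strong component is monotone once its ancestors
  have reached their final values. A word fixing all monotone networks therefore settles the next
  source component of the remaining graph, whatever its size, while \<open>s\<close> settles a component of
  size one and \<open>s s\<close> one of size two; no word unsettles what is settled. Hence each block
  \<open>s s W\<close> settles at least three further vertices, if that many are left, and \<open>r\<close> copies of \<open>s\<close>
  deal with the at most \<open>r\<close> vertices that remain.
\<close>

section \<open>Points, words and arcs\<close>

lemma cube_iff: "x \<in> cube n \<longleftrightarrow> (\<forall>i. i \<notin> {1..n} \<longrightarrow> x i = undefined)"
  by (auto simp: cube_def PiE_def extensional_def)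

lemma finite_cube: "finite (cube n)"
  by (simp add: cube_def finite_PiE)

lemma cube_upd: "x \<in> cube n \<Longrightarrow> i \<in> {1..n} \<Longrightarrow> x(i := b) \<in> cube n"
  by (auto simp: cube_iff)

lemma cube_eqI:
  assumes "x \<in> cube n" "y \<in> cube n" "\<And>i. i \<in> {1..n} \<Longrightarrow> x i = y i"
  shows "x = y"
proof
  show "x i = y i" for i
    using assms unfolding cube_iff by (cases "i \<in> {1..n}") auto
qed

lemma network_in_cube: "is_network n f \<Longrightarrow> x \<in> cube n \<Longrightarrow> f x \<in> cube n"
  by (auto simp: is_network_def)

lemma update_word_Nil [simp]: "update_word f [] x = x"
  by (simp add: update_word_def)

lemma update_word_Cons [simp]: "update_word f (i # w) x = update_word f w (update f i x)"
  by (simp add: update_word_def)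

lemma update_word_append [simp]:
  "update_word f (u @ v) x = update_word f v (update_word f u x)"
  by (simp add: update_word_def)

lemma update_word_cube:
  "w \<in> lists {1..n} \<Longrightarrow> x \<in> cube n \<Longrightarrow> update_word f w x \<in> cube n"
  by (induction w arbitrary: x) (auto simp: update_def cube_upd)

lemma update_word_fixed: "f x = x \<Longrightarrow> update_word f w x = x"
  by (induction w) (auto simp: update_def)

lemma update_word_filter:
  assumes "\<And>y i. i \<notin> C \<Longrightarrow> g y i = y i"
  shows "update_word g w x = update_word g (filter (\<lambda>i. i \<in> C) w) x"
  by (induction w arbitrary: x) (auto simp: update_def assms)

text \<open>Induction along a path from \<open>x\<close> to \<open>y\<close> that flips one
  differing component at a time. It reduces comparisons of two points to single flips, which is what
  arcs and their signs describe.\<close>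

lemma cube_exchange [consumes 2, case_names start step]:
  assumes "x \<in> cube n" "y \<in> cube n" "P x"
    and step: "\<And>z j. \<lbrakk>z \<in> cube n; j \<in> {1..n}; x j \<noteq> y j; z j = x j; P z\<rbrakk> \<Longrightarrow> P (z(j := y j))"
  shows "P y"
proof -
  let ?D = "{j \<in> {1..n}. x j \<noteq> y j}"
  \<comment> \<open>The intermediate points take the values of \<open>y\<close> on \<open>A\<close>
    and those of \<open>x\<close> elsewhere; \<open>A\<close> grows up to the set where the two
    differ.\<close>
  have exchange: "A \<subseteq> ?D \<longrightarrow> P (override_on x y A)" if "finite A" for A
    using that
  proof (induction A)
    case empty
    then show ?case using assms(3) by simp
  next
    case (insert j A)
    show ?case
    proof
      assume sub: "insert j A \<subseteq> ?D"
      have "override_on x y A \<in> cube n"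
        using assms(1,2) by (auto simp: cube_iff override_on_def)
      then have "P ((override_on x y A)(j := y j))"
        using insert sub by (intro step) auto
      then show "P (override_on x y (insert j A))"
        by (simp add: override_on_insert)
    qed
  qed
  have "override_on x y ?D = y"
    by (rule cube_eqI[of _ n]) (use assms(1,2) in \<open>auto simp: cube_iff override_on_def\<close>)
  then show ?thesis using exchange[of ?D] by simp
qed

section \<open>Arcs of the interaction graph and their signs\<close>

abbreviation arcs_of :: "nat \<Rightarrow> network \<Rightarrow> (nat \<times> nat) set" where
  "arcs_of n f \<equiv> parcs (interaction_graph n f)"

lemma pverts_interaction_graph [simp]: "pverts (interaction_graph n f) = {1..n}"
  by (simp add: interaction_graph_def)

lemma arcs_of_iff:
  "(j, i) \<in> arcs_of n f \<longleftrightarrow> j \<in> {1..n} \<and> i \<in> {1..n} \<and>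
     (\<exists>x\<in>cube n. \<exists>y\<in>cube n. {k \<in> {1..n}. x k \<noteq> y k} = {j} \<and> f x i \<noteq> f y i)"
  by (simp only: interaction_graph_def pair_pre_digraph.select_convs mem_Collect_eq prod.case)

lemma arcs_of_verts: "(j, i) \<in> arcs_of n f \<Longrightarrow> j \<in> {1..n} \<and> i \<in> {1..n}"
  by (simp only: arcs_of_iff)

lemma no_arc_upd:
  assumes "x \<in> cube n" "j \<in> {1..n}" "i \<in> {1..n}" "(j, i) \<notin> arcs_of n f"
  shows "f (x(j := b)) i = f x i"
proof (rule ccontr)
  assume ne: "f (x(j := b)) i \<noteq> f x i"
  have "b \<noteq> x j"
  proof
    assume "b = x j"
    then have "x(j := b) = x" by (simp only: fun_upd_triv)
    then show False using ne by simp
  qed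
  then have diff: "{k \<in> {1..n}. (x(j := b)) k \<noteq> x k} = {j}" using assms(2) by auto
  have "(j, i) \<in> arcs_of n f"
    unfolding arcs_of_iff
  proof (intro conjI assms(2,3))
    show "\<exists>u\<in>cube n. \<exists>v\<in>cube n. {k \<in> {1..n}. u k \<noteq> v k} = {j} \<and> f u i \<noteq> f v i"
    proof (rule bexI[of _ "x(j := b)"])
      show "\<exists>v\<in>cube n. {k \<in> {1..n}. (x(j := b)) k \<noteq> v k} = {j} \<and> f (x(j := b)) i \<noteq> f v i"
        by (rule bexI[of _ x]) (rule conjI[OF diff ne], rule assms(1))
      show "x(j := b) \<in> cube n" by (rule cube_upd[OF assms(1,2)])
    qed
  qed
  then show False using assms(4) by contradiction
qed

lemma arc_sign_increasing:
  assumes "arc_sign n f (j, i) = 1" "x \<in> cube n" "\<not> x j"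
  shows "f x i \<le> f (x(j := True)) i"
proof -
  have "\<forall>x\<in>cube n. \<not> x j \<longrightarrow> f x i \<le> f (x(j := True)) i"
    using assms(1) unfolding arc_sign_def prod.case by (metis one_neq_neg_one zero_neq_one)
  then show ?thesis using assms(2,3) by blast
qed

lemma arc_sign_decreasing:
  assumes "arc_sign n f (j, i) = - 1" "x \<in> cube n" "\<not> x j"
  shows "f (x(j := True)) i \<le> f x i"
proof -
  have "\<forall>x\<in>cube n. \<not> x j \<longrightarrow> f (x(j := True)) i \<le> f x i"
    using assms(1) unfolding arc_sign_def prod.case
    by (metis one_neq_neg_one zero_neq_neg_one)
  then show ?thesis using assms(2,3) by blast
qed

lemma depends_on_predecessors:
  assumes "x \<in> cube n" "y \<in> cube n" "i \<in> {1..n}"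
    and agree: "\<And>j. (j, i) \<in> arcs_of n f \<Longrightarrow> x j = y j"
  shows "f y i = f x i"
  using assms(1,2)
proof (induction rule: cube_exchange)
  case (step z j)
  have "(j, i) \<notin> arcs_of n f" using agree step(3) by auto
  then have "f (z(j := y j)) i = f z i" by (rule no_arc_upd[OF step(1,2) assms(3)])
  then show ?case using step(5) by (rule trans)
qed simp

section \<open>Potentials on digraphs with positive cycles\<close>

context wf_digraph
begin

text \<open>A closed walk that is not a cycle splits into two shorter closed walks, and by
  commutativity its product is the product of theirs; induction on the length.\<close>

lemma closed_walk_prod_1:
  fixes w :: "'b \<Rightarrow> 'c::comm_monoid_mult"
  assumes cyc: "\<And>c. cycle c \<Longrightarrow> prod_list (map w c) = 1" and "awalk u p u"
  shows "prod_list (map w p) = 1"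
  using assms(2)
proof (induction "length p" arbitrary: u p rule: less_induct)
  case less
  show ?case
  proof (cases p)
    case (Cons e es)
    show ?thesis
    proof (cases "distinct (tl (awalk_verts u p))")
      case True
      then show ?thesis using less.prems Cons cyc[of p] by (auto simp: cycle_def)
    next
      case False
      have es: "awalk (head G e) es u" and e: "e \<in> arcs G" "tail G e = u"
        using less.prems Cons by (auto simp: awalk_Cons_iff)
      \<comment> \<open>The repetition occurs after the first arc, so the closed subwalk
        \<open>r\<close> is cut out of \<open>es\<close>; then \<open>r\<close> and the remaining
        \<open>e # q @ s\<close> are both shorter than \<open>p\<close>.\<close>
      have "\<not> distinct (awalk_verts (head G e) es)" using False Cons by simp
      then obtain q r s v where d: "es = q @ r @ s" "0 < length r"
          "awalk (head G e) q v" "awalk v r v" "awalk v s u"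
        using awalk_not_distinct_decomp[OF es] by blast
      have "awalk u (e # q @ s) u"
        using d e by (auto simp: awalk_Cons_iff)
      then have "prod_list (map w (e # q @ s)) = 1"
        using less.hyps[of "e # q @ s" u] d Cons by auto
      moreover have "prod_list (map w r) = 1"
        using less.hyps[of r v] d Cons by auto
      ultimately show ?thesis using Cons d(1) by (simp add: ac_simps)
    qed
  qed simp
qed

text \<open>Harary's balance theorem on the strong component of \<open>v\<close>: the potential of
  \<open>u\<close> is the product of signs along some walk from \<open>v\<close> to
  \<open>u\<close>, and walks back to \<open>v\<close> show that every arc respects it.\<close>

lemma positive_cycles_potential:
  fixes w :: "'b \<Rightarrow> int"
  assumes cyc: "\<And>c. cycle c \<Longrightarrow> prod_list (map w c) = 1"
  shows "\<exists>\<sigma> :: 'a \<Rightarrow> bool. \<forall>e\<in>arcs G. v \<rightarrow>\<^sup>* tail G e \<longrightarrow> head G e \<rightarrow>\<^sup>* v \<longrightarrow>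
           w e = (if \<sigma> (tail G e) = \<sigma> (head G e) then 1 else - 1)"
proof -
  define val where "val u = prod_list (map w (SOME p. awalk v p u))" for u
  have walk: "\<exists>p. awalk v p u \<and> val u = prod_list (map w p)" if "v \<rightarrow>\<^sup>* u" for u
  proof -
    have "\<exists>p. awalk v p u" using that by (simp add: reachable_awalk)
    then have "awalk v (SOME p. awalk v p u) u" by (rule someI_ex)
    then show ?thesis by (auto simp: val_def)
  qed
  have val: "val (tail G e) \<in> {1, - 1} \<and> val (head G e) \<in> {1, - 1} \<and>
             w e = val (tail G e) * val (head G e)"
    if e: "e \<in> arcs G" and r1: "v \<rightarrow>\<^sup>* tail G e" and r2: "head G e \<rightarrow>\<^sup>* v" for e
  proof -
    have r3: "v \<rightarrow>\<^sup>* head G e"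
      using r1 e by (meson in_arcs_imp_in_arcs_ends reachable_adj_trans)
    obtain p where p: "awalk v p (tail G e)" "val (tail G e) = prod_list (map w p)"
      using walk[OF r1] by blast
    obtain p' where p': "awalk v p' (head G e)" "val (head G e) = prod_list (map w p')"
      using walk[OF r3] by blast
    obtain q where q: "awalk (head G e) q v" using r2 unfolding reachable_awalk by blast
    define c where "c = prod_list (map w q)"
    \<comment> \<open>Both closed walks return by the same \<open>q\<close>; one reaches the head of
      \<open>e\<close> through \<open>e\<close>, the other by the walk that defines its
      value.\<close>
    have "awalk v (p @ e # q) v" "awalk v (p' @ q) v"
      using p(1) p'(1) q e by (auto simp: awalk_Cons_iff intro: awalk_appendI)
    from this[THEN closed_walk_prod_1[of w, rotated]] cyc
    have "prod_list (map w (p @ e # q)) = 1" "prod_list (map w (p' @ q)) = 1" by blast+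
    then have 1: "val (tail G e) * (w e * c) = 1" and 2: "val (head G e) * c = 1"
      unfolding p(2) p'(2) c_def by simp_all
    \<comment> \<open>An integer product equals 1 only if both factors are 1 or both are -1, so all
      values involved are units and \<open>c\<close> can be eliminated.\<close>
    from 2 have "val (head G e) = 1 \<and> c = 1 \<or> val (head G e) = - 1 \<and> c = - 1"
      by (simp only: zmult_eq_1_iff)
    moreover from 1 have "val (tail G e) = 1 \<and> w e * c = 1 \<or> val (tail G e) = - 1 \<and> w e * c = - 1"
      by (simp only: zmult_eq_1_iff)
    ultimately show ?thesis by auto
  qed
  show ?thesis
  proof (intro exI[of _ "\<lambda>u. val u = 1"] ballI impI)
    fix e assume "e \<in> arcs G" "v \<rightarrow>\<^sup>* tail G e" "head G e \<rightarrow>\<^sup>* v"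
    from val[OF this]
    show "w e = (if (val (tail G e) = 1) = (val (head G e) = 1) then 1 else - 1)" by auto
  qed
qed

end

lemma wf_interaction_graph: "wf_digraph (with_proj (interaction_graph n f))"
  using arcs_of_verts[of _ _ n f] by unfold_locales (fastforce)+

section \<open>Settled sets of components\<close>

definition pred_closed :: "nat \<Rightarrow> network \<Rightarrow> nat set \<Rightarrow> bool" where
  "pred_closed n f D \<longleftrightarrow> D \<subseteq> {1..n} \<and> (\<forall>j i. (j, i) \<in> arcs_of n f \<longrightarrow> i \<in> D \<longrightarrow> j \<in> D)"

text \<open>Since \<open>D\<close> contains all its predecessors, its components see only each
  other, so their stable values are final under any further updates.\<close>

definition settled :: "nat \<Rightarrow> network \<Rightarrow> nat set \<Rightarrow> (nat \<Rightarrow> bool) \<Rightarrow> bool" where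
  "settled n f D x \<longleftrightarrow> x \<in> cube n \<and> pred_closed n f D \<and> (\<forall>i\<in>D. f x i = x i)"

text \<open>The sign condition is switching in signed graphs: negating the components where
  \<open>\<sigma>\<close> holds makes all arcs inside \<open>C\<close> positive. The set
  \<open>C\<close> may be empty.\<close>

definition switchable_extension :: "nat \<Rightarrow> network \<Rightarrow> nat set \<Rightarrow> nat set \<Rightarrow> bool" where
  "switchable_extension n f D C \<longleftrightarrow> C \<inter> D = {} \<and> pred_closed n f (D \<union> C) \<and>
     (\<exists>\<sigma> :: nat \<Rightarrow> bool. \<forall>a\<in>C. \<forall>b\<in>C. (a, b) \<in> arcs_of n f \<longrightarrow>
        arc_sign n f (a, b) = (if \<sigma> a = \<sigma> b then 1 else - 1))"

text \<open>The extension is a source component of the graph on the remaining vertices: the new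
  ancestors of a vertex with the fewest ancestors.\<close>

lemma switchable_extension_exists:
  assumes bal: "balanced_network n f" and D: "pred_closed n f D" and ne: "D \<noteq> {1..n}"
  shows "\<exists>C. C \<noteq> {} \<and> switchable_extension n f D C"
proof -
  let ?G = "with_proj (interaction_graph n f)"
  interpret wf_digraph ?G by (rule wf_interaction_graph)
  have V: "verts ?G = {1..n}" by simp
  define anc where "anc v = {u. u \<rightarrow>\<^sup>*\<^bsub>?G\<^esub> v}" for v
  have anc_sub: "anc v \<subseteq> {1..n}" for v
    unfolding anc_def using reachable_in_verts(1) V by auto
  then have fin: "finite (anc v)" for v by (meson finite_atLeastAtMost finite_subset)
  have "\<exists>v. v \<in> {1..n} - D" using D ne by (auto simp: pred_closed_def)
  then obtain v where v: "v \<in> {1..n} - D"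
    and least: "\<And>u. u \<in> {1..n} - D \<Longrightarrow> card (anc v) \<le> card (anc u)"
    using arg_min_natI[of "\<lambda>v. v \<in> {1..n} - D" _ "\<lambda>v. card (anc v)"]
      arg_min_nat_le[of "\<lambda>v. v \<in> {1..n} - D" _ "\<lambda>v. card (anc v)"] by metis
  have v_anc: "v \<in> anc v" using v V by (auto simp: anc_def)
  \<comment> \<open>An ancestor \<open>u\<close> outside \<open>D\<close> has its ancestors among
    those of \<open>v\<close> and, by minimality, no fewer of them. The two sets coincide, so
    \<open>v\<close> is an ancestor of \<open>u\<close>.\<close>
  have backward: "v \<rightarrow>\<^sup>*\<^bsub>?G\<^esub> u" if "u \<in> anc v - D" for u
  proof -
    have "anc u \<subseteq> anc v" using that by (auto simp: anc_def intro: reachable_trans)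
    moreover have "card (anc v) \<le> card (anc u)" using that anc_sub[of v] by (intro least) blast
    ultimately have "anc u = anc v" using fin card_seteq by metis
    then show ?thesis using v_anc by (auto simp: anc_def)
  qed
  have "\<exists>\<sigma> :: nat \<Rightarrow> bool. \<forall>e\<in>arcs ?G. v \<rightarrow>\<^sup>*\<^bsub>?G\<^esub> tail ?G e \<longrightarrow> head ?G e \<rightarrow>\<^sup>*\<^bsub>?G\<^esub> v \<longrightarrow>
      arc_sign n f e = (if \<sigma> (tail ?G e) = \<sigma> (head ?G e) then 1 else - 1)"
    using bal unfolding balanced_network_def
    by (intro positive_cycles_potential) blast
  then obtain \<sigma> :: "nat \<Rightarrow> bool" where \<sigma>: "\<forall>e\<in>arcs_of n f.
      v \<rightarrow>\<^sup>*\<^bsub>?G\<^esub> fst e \<longrightarrow> snd e \<rightarrow>\<^sup>*\<^bsub>?G\<^esub> v \<longrightarrow>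
      arc_sign n f e = (if \<sigma> (fst e) = \<sigma> (snd e) then 1 else - 1)"
    unfolding with_proj_simps ..
  have "pred_closed n f (D \<union> (anc v - D))"
    unfolding pred_closed_def
  proof (intro conjI allI impI)
    show "D \<union> (anc v - D) \<subseteq> {1..n}" using D anc_sub by (auto simp: pred_closed_def)
  next
    fix j i assume ji: "(j, i) \<in> arcs_of n f" "i \<in> D \<union> (anc v - D)"
    then have "i \<in> anc v \<Longrightarrow> j \<in> anc v"
      unfolding anc_def using adj_reachable_trans[of j i v] by simp
    then show "j \<in> D \<union> (anc v - D)" using ji D by (auto simp: pred_closed_def)
  qed
  moreover have "arc_sign n f (a, b) = (if \<sigma> a = \<sigma> b then 1 else - 1)"
    if "a \<in> anc v - D" "b \<in> anc v - D" "(a, b) \<in> arcs_of n f" for a b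
  proof -
    have "v \<rightarrow>\<^sup>*\<^bsub>?G\<^esub> a" by (rule backward[OF that(1)])
    moreover have "b \<rightarrow>\<^sup>*\<^bsub>?G\<^esub> v" using that(2) unfolding anc_def by blast
    ultimately show ?thesis using bspec[OF \<sigma> that(3)] unfolding fst_conv snd_conv by blast
  qed
  ultimately have "switchable_extension n f D (anc v - D)"
    unfolding switchable_extension_def by blast
  moreover have "anc v - D \<noteq> {}" using v v_anc by blast
  ultimately show ?thesis by (intro exI[of _ "anc v - D"] conjI)
qed

text \<open>Freezing the settled components and negating the components of \<open>C\<close> selected by \<open>\<sigma>\<close>
  turns the dynamics on \<open>C\<close> into that of a network \<open>g\<close> that is monotone.\<close>

lemma settled_extend:
  assumes net: "is_network n f" and set: "settled n f D x" and C: "switchable_extension n f D C"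
    and w: "w \<in> lists {1..n}"
    and fixing: "\<And>g. \<lbrakk>monotone_network n g; \<And>y i. i \<notin> C \<Longrightarrow> g y i = y i\<rbrakk> \<Longrightarrow> word_fixes n w g"
  shows "settled n f (D \<union> C) (update_word f w x)"
proof -
  have x: "x \<in> cube n" and D: "pred_closed n f D" and fixD: "\<And>i. i \<in> D \<Longrightarrow> f x i = x i"
    using set by (auto simp: settled_def)
  have disj: "C \<inter> D = {}" and DC: "pred_closed n f (D \<union> C)"
    using C by (simp_all only: switchable_extension_def)
  from C have "\<exists>\<sigma> :: nat \<Rightarrow> bool. \<forall>a\<in>C. \<forall>b\<in>C. (a, b) \<in> arcs_of n f \<longrightarrow>
      arc_sign n f (a, b) = (if \<sigma> a = \<sigma> b then 1 else - 1)"
    by (simp only: switchable_extension_def)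
  then obtain \<sigma> :: "nat \<Rightarrow> bool" where switch: "\<forall>a\<in>C. \<forall>b\<in>C. (a, b) \<in> arcs_of n f \<longrightarrow>
      arc_sign n f (a, b) = (if \<sigma> a = \<sigma> b then 1 else - 1)" ..
  have \<sigma>: "arc_sign n f (a, b) = (if \<sigma> a = \<sigma> b then 1 else - 1)"
    if "a \<in> C" "b \<in> C" "(a, b) \<in> arcs_of n f" for a b
    using switch that by blast
  have Csub: "C \<subseteq> {1..n}" and Dsub: "D \<subseteq> {1..n}" using DC by (auto simp: pred_closed_def)
  \<comment> \<open>\<open>m\<close> decodes a state of \<open>g\<close> into a state of
    \<open>f\<close>: negation by \<open>\<sigma>\<close> on \<open>C\<close>, the values of
    \<open>x\<close> elsewhere. \<open>g\<close> is \<open>f\<close> in these coordinates on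
    \<open>C\<close> and the identity off \<open>C\<close>.\<close>
  define m where "m y = (\<lambda>j. if j \<in> C then y j \<noteq> \<sigma> j else x j)" for y
  define g where "g y = (\<lambda>i. if i \<in> C then f (m y) i \<noteq> \<sigma> i else y i)" for y
  have m_cube: "m y \<in> cube n" for y using x Csub by (auto simp: cube_iff m_def)
  have g_off: "i \<notin> C \<Longrightarrow> g y i = y i" for y i by (simp add: g_def)
  have g_net: "is_network n g"
    unfolding is_network_def
  proof
    fix y assume "y \<in> cube n"
    moreover have "i \<notin> C" if "i \<notin> {1..n}" for i using that Csub by blast
    ultimately show "g y \<in> cube n" by (simp add: cube_iff g_def)
  qed
  have g_mono: "g y i \<le> g y' i"
    if yy: "y \<in> cube n" "y' \<in> cube n" and le: "\<forall>i\<in>{1..n}. y i \<le> y' i" and i: "i \<in> {1..n}" for y y' i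
  proof (cases "i \<in> C")
    case False
    then show ?thesis using le i by (simp add: g_def)
  next
    case iC: True
    from yy show ?thesis
    proof (induction rule: cube_exchange)
      case start
      then show ?case by simp
    next
      case (step z j)
      have "y j \<le> y' j" using le step(2) by blast
      then have zj: "\<not> z j" "y' j" using step(3,4) by auto
      have "g z i \<le> g (z(j := y' j)) i"
      proof (cases "j \<in> C")
        case False
        then have "m (z(j := y' j)) = m z" by (auto simp: m_def)
        then show ?thesis using iC by (simp add: g_def)
      next
        case jC: True
        have mz: "m (z(j := y' j)) = (m z)(j := \<not> \<sigma> j)" and mzj: "m z j = \<sigma> j"
          using jC zj by (auto simp: m_def fun_eq_iff)
        show ?thesis
        proof (cases "(j, i) \<in> arcs_of n f")
          case False
          then show ?thesis
            using no_arc_upd[OF m_cube \<open>j \<in> {1..n}\<close> i, of f] iC by (simp add: g_def mz)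
        next
          case True
          \<comment> \<open>\<open>h\<close> is \<open>f\<close> at \<open>i\<close> as a function
            of component \<open>j\<close> alone. It increases if \<open>\<sigma>\<close> agrees on
            \<open>j\<close> and \<open>i\<close> and decreases otherwise; the negations at input
            and output turn both cases into an increase of \<open>g\<close>.\<close>
          define h where "h b = f ((m z)(j := b)) i" for b
          have flip: "((m z)(j := False))(j := True) = (m z)(j := True)" by (rule fun_upd_upd)
          have cube: "(m z)(j := False) \<in> cube n" by (rule cube_upd[OF m_cube step(2)])
          have up: "h False \<le> h True" if "\<sigma> j = \<sigma> i"
            using arc_sign_increasing[OF _ cube, of f j i] \<sigma>[OF jC iC True] that
            by (simp only: h_def flip fun_upd_same simp_thms if_True)
          have down: "h True \<le> h False" if "\<sigma> j \<noteq> \<sigma> i"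
            using arc_sign_decreasing[OF _ cube, of f j i] \<sigma>[OF jC iC True] that
            by (simp only: h_def flip fun_upd_same simp_thms if_False)
          have "(m z)(j := \<sigma> j) = m z" unfolding mzj[symmetric] by (rule fun_upd_triv)
          then have "g z i \<longleftrightarrow> h (\<sigma> j) \<noteq> \<sigma> i" "g (z(j := y' j)) i \<longleftrightarrow> h (\<not> \<sigma> j) \<noteq> \<sigma> i"
            using iC by (simp_all only: g_def mz h_def if_True)
          then show ?thesis using up down by (cases "\<sigma> i"; cases "\<sigma> j") auto
        qed
      qed
      with step(5) show ?case by (rule order_trans)
    qed
  qed
  have "monotone_network n g"
    unfolding monotone_network_def using g_net g_mono by blast
  then have fixg: "word_fixes n w g" by (rule fixing) (rule g_off)
  \<comment> \<open>The encoding of the start: \<open>m z\<close> is \<open>x\<close>, because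
    negating twice by \<open>\<sigma>\<close> cancels.\<close>
  define z where "z = (\<lambda>i. if i \<in> C then x i \<noteq> \<sigma> i else x i)"
  have z: "z \<in> cube n" using x Csub by (auto simp: cube_iff z_def)
  \<comment> \<open>The run of \<open>f\<close> from \<open>x\<close> simulates that of
    \<open>g\<close> from \<open>z\<close> on \<open>C\<close> and is constant on \<open>D\<close>.
    Elsewhere \<open>f\<close> may move while \<open>m\<close> stays at \<open>x\<close>; this does
    no harm, as no arc enters \<open>D \<union> C\<close> from outside.\<close>
  have follow: "(\<forall>i\<in>C. update_word f v x i = m (update_word g v z) i) \<and>
        (\<forall>i\<in>D. update_word f v x i = x i)" if "v \<in> lists {1..n}" for v
    using that
  proof (induction v rule: rev_induct)
    case Nil
    then show ?case by (auto simp: m_def z_def)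
  next
    case (snoc k v)
    let ?x = "update_word f v x" and ?y = "update_word g v z"
    have k: "k \<in> {1..n}" and v: "v \<in> lists {1..n}" using snoc.prems by auto
    have IH: "\<And>i. i \<in> C \<Longrightarrow> ?x i = m ?y i" "\<And>i. i \<in> D \<Longrightarrow> ?x i = x i"
      using snoc.IH[OF v] by auto
    have xc: "?x \<in> cube n" by (rule update_word_cube[OF v x])
    have fD: "f ?x k = x k" if "k \<in> D"
    proof -
      have "f ?x k = f x k"
        using that D IH(2) by (intro depends_on_predecessors[OF x xc k]) (auto simp: pred_closed_def)
      then show ?thesis using fixD that by simp
    qed
    have fC: "f ?x k = m (update g k ?y) k" if "k \<in> C"
    proof -
      have "f ?x k = f (m ?y) k"
      proof (rule depends_on_predecessors[OF m_cube xc k])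
        fix j assume "(j, k) \<in> arcs_of n f"
        then have "j \<in> D \<union> C" using DC that by (auto simp: pred_closed_def)
        then show "m ?y j = ?x j" using IH disj by (auto simp: m_def)
      qed
      then show ?thesis using that by (auto simp: m_def update_def g_def)
    qed
    have "update f k ?x i = m (update g k ?y) i" if "i \<in> C" for i
    proof (cases "i = k")
      case True
      then show ?thesis using fC that by (simp add: update_def[of f])
    next
      case False
      then have "m (update g k ?y) i = m ?y i" by (simp add: m_def update_def)
      then show ?thesis using False IH(1)[OF that] by (simp add: update_def[of f])
    qed
    moreover have "update f k ?x i = x i" if "i \<in> D" for i
      using that fD IH(2) by (auto simp: update_def)
    ultimately show ?case by simp
  qed
  let ?x = "update_word f w x" and ?y = "update_word g w z"
  have xc: "?x \<in> cube n" by (rule update_word_cube[OF w x])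
  have gy: "g ?y = ?y" using fixg z by (simp add: word_fixes_def)
  have onC: "?x i = m ?y i" if "i \<in> C" for i using follow[OF w] that by auto
  have onD: "?x i = x i" if "i \<in> D" for i using follow[OF w] that by auto
  have "f ?x i = ?x i" if "i \<in> D \<union> C" for i
  proof -
    have i: "i \<in> {1..n}" using that Csub Dsub by auto
    have eq: "f ?x i = f (m ?y) i"
    proof (rule depends_on_predecessors[OF m_cube xc i])
      fix j assume "(j, i) \<in> arcs_of n f"
      then have "j \<in> D \<union> C" using DC that by (auto simp: pred_closed_def)
      then show "m ?y j = ?x j" using onC onD disj by (auto simp: m_def)
    qed
    show ?thesis
    proof (cases "i \<in> C")
      case True
      then have "g ?y i \<longleftrightarrow> f (m ?y) i \<noteq> \<sigma> i" "m ?y i \<longleftrightarrow> ?y i \<noteq> \<sigma> i"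
        by (simp_all only: g_def m_def if_True)
      then show ?thesis using eq onC[OF True] fun_cong[OF gy, of i] by metis
    next
      case False
      then have iD: "i \<in> D" using that by auto
      have "f ?x i = f x i"
        using iD D onD by (intro depends_on_predecessors[OF x xc i]) (auto simp: pred_closed_def)
      then show ?thesis using fixD onD iD by simp
    qed
  qed
  then show ?thesis using xc DC by (simp add: settled_def)
qed

text \<open>Extension by the empty set: the only \<open>g\<close> to consider is then the identity,
  which every word fixes.\<close>

lemma settled_preserved:
  assumes "is_network n f" "settled n f D x" "w \<in> lists {1..n}"
  shows "settled n f D (update_word f w x)"
proof -
  have "switchable_extension n f D {}"
    using assms(2) by (auto simp: switchable_extension_def settled_def)
  moreover have "word_fixes n w g" if "\<And>y i. i \<notin> {} \<Longrightarrow> g y i = y i" for g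
  proof -
    have "g y = y" for y using that by auto
    then show ?thesis by (simp add: word_fixes_def)
  qed
  ultimately show ?thesis
    using settled_extend[OF assms(1,2) _ assms(3), of "{}"] by simp
qed

section \<open>Components of size one and two\<close>

text \<open>If the update of \<open>v\<close> raises \<open>x\<close>, monotonicity gives
  \<open>g\<close> at the new point a value at least as large, so it stays true; dually if it lowers
  \<open>x\<close>. One update is enough.\<close>

lemma word_fixes_single:
  assumes mono: "monotone_network n g" and off: "\<And>y i. i \<notin> {v} \<Longrightarrow> g y i = y i"
    and v: "v \<in> {1..n}" and w: "filter (\<lambda>i. i \<in> {v}) w = [v]"
  shows "word_fixes n w g"
  unfolding word_fixes_def
proof
  fix x assume x: "x \<in> cube n"
  define y where "y = x(v := g x v)"
  have y: "y \<in> cube n" unfolding y_def using x v by (rule cube_upd)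
  have le: "g a v \<le> g b v" if "a \<in> cube n" "b \<in> cube n" "\<forall>i\<in>{1..n}. a i \<le> b i" for a b
    using mono v that unfolding monotone_network_def by blast
  have "g y v = y v"
  proof (cases "g x v = x v")
    case True
    then have "y = x" by (auto simp: y_def)
    then show ?thesis using True by simp
  next
    case False
    then show ?thesis using le[OF x y] le[OF y x] by (cases "x v") (auto simp: y_def)
  qed
  then have "g y i = y i" for i using off[of i y] by (cases "i = v") auto
  then have "g y = y" by (rule ext)
  moreover have "update_word g w x = y"
    using update_word_filter[of "{v}" g w x] off w by (simp add: update_def y_def)
  ultimately show "g (update_word g w x) = update_word g w x" by simp
qed

text \<open>The right-hand sides are the general form of a monotone function of two Boolean
  variables. With monotonicity built in, stability after updating in the order \<open>A\<close>,
  \<open>B\<close>, \<open>A\<close>, \<open>B\<close> is a propositional fact.\<close>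

lemma monotone_pair_stabilizes:
  fixes A B :: "bool \<Rightarrow> bool \<Rightarrow> bool"
  assumes A: "\<And>p q. A p q \<longleftrightarrow> a0 \<or> p \<and> a1 \<or> q \<and> a2 \<or> p \<and> q \<and> a3"
    and B: "\<And>p q. B p q \<longleftrightarrow> b0 \<or> p \<and> b1 \<or> q \<and> b2 \<or> p \<and> q \<and> b3"
  shows "p1 = A p q \<Longrightarrow> q1 = B p1 q \<Longrightarrow> p2 = A p1 q1 \<Longrightarrow> q2 = B p2 q1 \<Longrightarrow>
    A p2 q2 = p2 \<and> B p2 q2 = q2"
  unfolding A B by argo

lemma word_fixes_pair:
  assumes mono: "monotone_network n g" and off: "\<And>y i. i \<notin> {a, b} \<Longrightarrow> g y i = y i"
    and ab: "a \<in> {1..n}" "b \<in> {1..n}" "a \<noteq> b"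
    and w: "filter (\<lambda>i. i \<in> {a, b}) w = [a, b, a, b]"
  shows "word_fixes n w g"
  unfolding word_fixes_def
proof
  fix x assume x: "x \<in> cube n"
  \<comment> \<open>Only \<open>a\<close> and \<open>b\<close> ever move, so each state of the run
    is \<open>X p q\<close> for a pair of bits.\<close>
  define X where "X p q = x(a := p, b := q)" for p q
  define A where "A p q = g (X p q) a" for p q
  define B where "B p q = g (X p q) b" for p q
  have X: "X p q \<in> cube n" for p q unfolding X_def using x ab by (intro cube_upd)
  have le: "A p q \<le> A p' q' \<and> B p q \<le> B p' q'" if "p \<le> p'" "q \<le> q'" for p q p' q'
  proof -
    have "\<forall>i\<in>{1..n}. X p q i \<le> X p' q' i" using that by (auto simp: X_def)
    then show ?thesis
      unfolding A_def B_def using mono ab X unfolding monotone_network_def by blast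
  qed
  have ua: "update g a (X p q) = X (A p q) q" and ub: "update g b (X p q) = X p (B p q)" for p q
    using ab by (auto simp: update_def X_def A_def B_def fun_eq_iff)
  have fixI: "g (X p q) = X p q" if "A p q = p" "B p q = q" for p q
  proof
    fix i
    show "g (X p q) i = X p q i"
    proof (cases "i \<in> {a, b}")
      case True
      then show ?thesis using that ab by (auto simp: A_def B_def) (auto simp: X_def)
    next
      case False
      then show ?thesis by (rule off)
    qed
  qed
  \<comment> \<open>Monotonicity lets each function be written as the disjunction of its four
    values, each guarded only by the inputs that are true.\<close>
  have A_form: "A p q \<longleftrightarrow> A False False \<or> p \<and> A True False \<or> q \<and> A False True \<or> p \<and> q \<and> A True True"
    and B_form: "B p q \<longleftrightarrow> B False False \<or> p \<and> B True False \<or> q \<and> B False True \<or> p \<and> q \<and> B True True"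
    for p q
    using le[of False True False False] le[of False False False True]
      le[of False True True True] le[of True True False True] le[of False True False True]
    by (cases p; cases q; auto)+
  have x0: "x = X (x a) (x b)" by (auto simp: X_def)
  define p1 where "p1 = A (x a) (x b)"
  define q1 where "q1 = B p1 (x b)"
  define p2 where "p2 = A p1 q1"
  define q2 where "q2 = B p2 q1"
  have "update_word g w x = update_word g [a, b, a, b] x"
    using update_word_filter[of "{a, b}" g w x] off w by simp
  also have "\<dots> = X p2 q2"
    by (subst x0) (simp add: ua ub p1_def q1_def p2_def q2_def)
  finally have "update_word g w x = X p2 q2" .
  moreover have "A p2 q2 = p2 \<and> B p2 q2 = q2"
    by (rule monotone_pair_stabilizes[OF A_form B_form p1_def q1_def p2_def q2_def])
  ultimately show "g (update_word g w x) = update_word g w x" using fixI by metis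
qed

lemma word_s_lists: "word_s n \<in> lists {1..n}"
  by (auto simp: word_s_def)

lemma filter_word_s:
  assumes "sorted u" "distinct u" "set u \<subseteq> {1..n}"
  shows "filter (\<lambda>i. i \<in> set u) (word_s n) = u"
  by (rule sorted_distinct_set_unique)
    (use assms in \<open>auto simp: word_s_def sorted_wrt_filter simp del: upt_Suc\<close>)

lemma settled_extend_single:
  assumes "is_network n f" "settled n f D x" "switchable_extension n f D C" "card C = 1"
  shows "settled n f (D \<union> C) (update_word f (word_s n) x)"
proof (rule settled_extend[OF assms(1-3) word_s_lists])
  obtain v where C: "C = {v}" using assms(4) card_1_singletonE by blast
  have v: "v \<in> {1..n}" using assms(3) by (auto simp: C switchable_extension_def pred_closed_def)
  fix g assume "monotone_network n g" "\<And>y i. i \<notin> C \<Longrightarrow> g y i = y i"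
  then show "word_fixes n (word_s n) g"
    using word_fixes_single[of n g v] v filter_word_s[of "[v]" n] C by simp
qed

lemma settled_extend_pair:
  assumes "is_network n f" "settled n f D x" "switchable_extension n f D C" "card C = 2"
  shows "settled n f (D \<union> C) (update_word f (word_s n @ word_s n) x)"
proof (rule settled_extend[OF assms(1-3)])
  \<comment> \<open>The order matters: \<open>s\<close> visits \<open>a\<close> before
    \<open>b\<close>, so \<open>s s\<close> restricted to \<open>C\<close> reads
    \<open>a b a b\<close>.\<close>
  obtain a b where C: "C = {a, b}" "a < b"
    using assms(4) by (metis card_2_iff doubleton_eq_iff linorder_neqE_nat)
  have ab: "a \<in> {1..n}" "b \<in> {1..n}"
    using assms(3) by (auto simp: C switchable_extension_def pred_closed_def)
  fix g assume "monotone_network n g" "\<And>y i. i \<notin> C \<Longrightarrow> g y i = y i"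
  then show "word_fixes n (word_s n @ word_s n) g"
    using word_fixes_pair[of n g a b] ab filter_word_s[of "[a, b]" n] C by simp
qed (use word_s_lists in auto)

section \<open>Counting settled components\<close>

lemma settled_all_fixed:
  assumes "is_network n f" "settled n f D x" "n \<le> card D"
  shows "f x = x"
proof (rule cube_eqI)
  have "D = {1..n}"
    using assms(2,3) by (intro card_seteq) (auto simp: settled_def pred_closed_def)
  then show "\<And>i. i \<in> {1..n} \<Longrightarrow> f x i = x i" using assms(2) by (auto simp: settled_def)
qed (use assms network_in_cube in \<open>auto simp: settled_def\<close>)

lemma settled_next:
  assumes "balanced_network n f" "settled n f D x" "card D < n"
  obtains C where "switchable_extension n f D C" "card C \<ge> 1" "card (D \<union> C) = card D + card C"
    "card D + card C \<le> n"
proof -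
  have "D \<noteq> {1..n}" using assms(3) by auto
  then obtain C where C: "C \<noteq> {}" "switchable_extension n f D C"
    using switchable_extension_exists assms by (metis settled_def)
  then have sub: "D \<union> C \<subseteq> {1..n}" "C \<inter> D = {}"
    by (auto simp: switchable_extension_def pred_closed_def)
  then have fin: "finite C" "finite D"
    using finite_subset[OF sub(1)] by auto
  have "card (D \<union> C) = card D + card C" using fin sub(2) by (intro card_Un_disjoint) auto
  moreover have "card (D \<union> C) \<le> n" using card_mono[OF _ sub(1)] by simp
  moreover have "card C \<ge> 1" using C fin by (simp add: Suc_leI card_gt_0_iff)
  ultimately show ?thesis using that C by simp
qed

text \<open>The cap at \<open>n\<close> covers states with fewer than \<open>k\<close> unsettled
  vertices. Quantifying over all settled \<open>D\<close> makes gains add up under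
  concatenation.\<close>

definition gains :: "nat \<Rightarrow> network \<Rightarrow> nat \<Rightarrow> nat list \<Rightarrow> bool" where
  "gains n f k w \<longleftrightarrow> (\<forall>D x. settled n f D x \<longrightarrow>
     (\<exists>D'. settled n f D' (update_word f w x) \<and> min n (card D + k) \<le> card D'))"

lemma gains_append: "gains n f j u \<Longrightarrow> gains n f k v \<Longrightarrow> gains n f (j + k) (u @ v)"
  unfolding gains_def
proof (intro allI impI)
  fix D x
  assume u: "\<forall>D x. settled n f D x \<longrightarrow>
      (\<exists>D'. settled n f D' (update_word f u x) \<and> min n (card D + j) \<le> card D')"
    and v: "\<forall>D x. settled n f D x \<longrightarrow>
      (\<exists>D'. settled n f D' (update_word f v x) \<and> min n (card D + k) \<le> card D')"
    and "settled n f D x"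
  then obtain E where E: "settled n f E (update_word f u x)" "min n (card D + j) \<le> card E"
    by blast
  then obtain F where "settled n f F (update_word f v (update_word f u x))"
    "min n (card E + k) \<le> card F" using v by blast
  then show "\<exists>D'. settled n f D' (update_word f (u @ v) x) \<and> min n (card D + (j + k)) \<le> card D'"
    using E(2) by (intro exI[of _ F]) auto
qed

lemma gains_word_power: "gains n f k u \<Longrightarrow> gains n f (q * k) (word_power q u)"
proof (induction q)
  case 0
  then show ?case by (auto simp: gains_def word_power_def)
next
  case (Suc q)
  then show ?case using gains_append by (fastforce simp: word_power_def)
qed

lemma gains_fixing_word:
  assumes bal: "balanced_network n f" and W: "fixes_all n monotone_network W"
    and "settled n f D x" "switchable_extension n f D C"
  shows "settled n f (D \<union> C) (update_word f W x)"
  using settled_extend[OF _ assms(3,4)] bal W by (simp add: balanced_network_def fixes_all_def)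

lemma gains_block:
  assumes bal: "balanced_network n f" and W: "fixes_all n monotone_network W"
  shows "gains n f 3 (word_s n @ word_s n @ W)"
  unfolding gains_def
proof (intro allI impI)
  fix D x assume st: "settled n f D x"
  let ?s = "word_s n"
  let ?goal = "\<exists>D'. settled n f D' (update_word f (?s @ ?s @ W) x) \<and> min n (card D + 3) \<le> card D'"
  have net: "is_network n f" using bal by (simp add: balanced_network_def)
  have keep: "settled n f E (update_word f ?s y)" if "settled n f E y" for E y
    using settled_preserved[OF net that word_s_lists] .
  have keepW: "settled n f E (update_word f W y)" if "settled n f E y" for E y
    using settled_preserved[OF net that] W by (simp add: fixes_all_def)
  \<comment> \<open>\<open>W\<close> settles at least one more vertex as long as one is
    left.\<close>
  have one: "\<exists>E'. settled n f E' (update_word f W y) \<and> min n (card E + 1) \<le> card E'"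
    if E: "settled n f E y" for E y
  proof (cases "card E < n")
    case True
    obtain C where C: "switchable_extension n f E C" "card C \<ge> 1" "card (E \<union> C) = card E + card C"
      "card E + card C \<le> n" by (rule settled_next[OF bal E True])
    show ?thesis using gains_fixing_word[OF bal W E C(1)] C by (intro exI[of _ "E \<union> C"]) simp
  next
    case False
    then show ?thesis using keepW[OF E] by (intro exI[of _ E]) simp
  qed
  show ?goal
  proof (cases "card D < n")
    case False
    then show ?thesis using keepW[OF keep[OF keep[OF st]]] by (intro exI[of _ D]) simp
  next
    case True
    obtain C where C: "switchable_extension n f D C" "card C \<ge> 1" "card (D \<union> C) = card D + card C"
      "card D + card C \<le> n" by (rule settled_next[OF bal st True])
    \<comment> \<open>Size at least three: \<open>W\<close> settles \<open>C\<close> after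
      \<open>s s\<close> has preserved \<open>D\<close>. Size two: \<open>s s\<close> settles
      \<open>C\<close> and \<open>W\<close> one more vertex. Size one: the first \<open>s\<close>
      settles \<open>C\<close>, and the next component decides.\<close>
    consider "card C = 1" | "card C = 2" | "card C \<ge> 3" using C(2) by linarith
    then show ?thesis
    proof cases
      case 1
      let ?E = "D \<union> C" and ?y = "update_word f ?s x"
      have E: "settled n f ?E ?y" by (rule settled_extend_single[OF net st C(1) 1])
      show ?thesis
      proof (cases "card ?E < n")
        case False
        then show ?thesis using keepW[OF keep[OF E]] by (intro exI[of _ ?E]) simp
      next
        case True
        obtain C' where C': "switchable_extension n f ?E C'" "card C' \<ge> 1"
          "card (?E \<union> C') = card ?E + card C'" "card ?E + card C' \<le> n"
          by (rule settled_next[OF bal E True])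
        show ?thesis
        \<comment> \<open>If \<open>C'\<close> is a single vertex, the second \<open>s\<close>
          settles it and \<open>W\<close> a third vertex; otherwise \<open>W\<close> settles all of
          \<open>C'\<close>, at least two vertices.\<close>
        proof (cases "card C' = 1")
          case True
          show ?thesis
            using one[OF settled_extend_single[OF net E C'(1) True]] C'(3) C(3) 1 True by auto
        next
          case False
          then show ?thesis
            using gains_fixing_word[OF bal W keep[OF E] C'(1)] C' C(3) 1
            by (intro exI[of _ "?E \<union> C'"]) simp
        qed
      qed
    next
      case 2
      then show ?thesis using one[OF settled_extend_pair[OF net st C(1) 2]] C(3) by auto
    next
      case 3
      then show ?thesis
        using gains_fixing_word[OF bal W keep[OF keep[OF st]] C(1)] C
        by (intro exI[of _ "D \<union> C"]) simp
    qed
  qed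
qed

lemma settle_remainder:
  assumes bal: "balanced_network n f" and st: "settled n f D x"
    and "r < 3" "n \<le> card D + r"
  shows "\<exists>D'. settled n f D' (update_word f (word_power r (word_s n)) x) \<and> n \<le> card D'"
proof -
  let ?s = "word_s n"
  have net: "is_network n f" using bal by (simp add: balanced_network_def)
  have one: "\<exists>E'. settled n f E' (update_word f ?s y) \<and> n \<le> card E'"
    if E: "settled n f E y" "n \<le> card E + 1" for E y
  proof (cases "card E < n")
    case True
    obtain C where C: "switchable_extension n f E C" "card C \<ge> 1" "card (E \<union> C) = card E + card C"
      "card E + card C \<le> n" by (rule settled_next[OF bal E(1) True])
    then have "card C = 1" using E(2) by simp
    then show ?thesis using settled_extend_single[OF net E(1) C(1)] C E(2) by (metis)
  next
    case False
    then show ?thesis using settled_preserved[OF net E(1) word_s_lists] by auto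
  qed
  consider "r = 0" | "r = 1" | "r = 2" using assms(3) by linarith
  then show ?thesis
  proof cases
    case 1
    then show ?thesis using assms by (auto simp: word_power_def)
  next
    case 2
    then show ?thesis using one[OF st] assms(4) by (simp add: word_power_def)
  next
    case 3
    have split: "word_power r ?s = ?s @ ?s" using 3 by (simp add: word_power_def numeral_2_eq_2)
    show ?thesis
    proof (cases "n \<le> card D + 1")
      case True
      then show ?thesis
        using one[OF settled_preserved[OF net st word_s_lists]] by (simp add: split)
    next
      case False
      then have "card D < n" by simp
      then obtain C where C: "switchable_extension n f D C" "card C \<ge> 1"
        "card (D \<union> C) = card D + card C" "card D + card C \<le> n" by (rule settled_next[OF bal st])
      \<comment> \<open>Exactly two vertices are left: they form one component, settled by
        \<open>s s\<close>, or each \<open>s\<close> settles one of them.\<close>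
      consider "card C = 1" | "card C = 2" using C 3 assms(4) by linarith
      then show ?thesis
      proof cases
        case 1
        then have "n \<le> card (D \<union> C) + 1" using C(3) assms(4) 3 by simp
        then show ?thesis
          using one[OF settled_extend_single[OF net st C(1) 1]] by (simp add: split)
      next
        case 2
        have "settled n f (D \<union> C) (update_word f (word_power r ?s) x)"
          unfolding split by (rule settled_extend_pair[OF net st C(1) 2])
        moreover have "n \<le> card (D \<union> C)" using C(3) 2 3 assms(4) by simp
        ultimately show ?thesis by blast
      qed
    qed
  qed
qed

lemma word_tilde_fixes:
  assumes "n = 3 * q + r" "r < 3" "fixes_all n monotone_network W" "balanced_network n f"
  shows "word_fixes n (word_tilde n q r W) f"
  unfolding word_fixes_def
proof
  fix x assume "x \<in> cube n"
  then have "settled n f {} x" by (simp add: settled_def pred_closed_def)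
  then obtain D where D: "settled n f D
      (update_word f (word_power q (word_s n @ word_s n @ W)) x)" "min n (q * 3) \<le> card D"
    using gains_word_power[OF gains_block[OF assms(4,3)], of q] unfolding gains_def by force
  have "n \<le> card D + r" using D(2) assms(1) by simp
  from settle_remainder[OF assms(4) D(1) assms(2) this]
  show "f (update_word f (word_tilde n q r W) x) = update_word f (word_tilde n q r W) x"
    using settled_all_fixed assms(4) unfolding word_tilde_def balanced_network_def by auto
qed

section \<open>Existence of words fixing all monotone networks\<close>

text \<open>Lowering a component \<open>i\<close> with \<open>f x i < x i\<close> keeps the point
  above its image: by monotonicity the image can only drop, and at \<open>i\<close> it is already
  false. The number of true components decreases.\<close>

lemma monotone_descends:
  assumes mono: "monotone_network n f" and "x \<in> cube n" "\<forall>i\<in>{1..n}. f x i \<le> x i"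
  shows "\<exists>w\<in>lists {1..n}. f (update_word f w x) = update_word f w x"
  using assms(2,3)
proof (induction "card {i \<in> {1..n}. x i}" arbitrary: x rule: less_induct)
  case less
  show ?case
  proof (cases "f x = x")
    case True
    then show ?thesis by (intro bexI[of _ "[]"]) auto
  next
    case False
    have "f x \<in> cube n" using mono less.prems network_in_cube by (auto simp: monotone_network_def)
    then obtain i where i: "i \<in> {1..n}" "f x i \<noteq> x i"
      using False cube_eqI less.prems(1) by metis
    then have v: "x i" "\<not> f x i" using less.prems(2) by (metis le_boolD)+
    let ?y = "update f i x"
    have upd: "?y = x(i := False)" using v by (simp add: update_def)
    have y: "?y \<in> cube n" using less.prems(1) i(1) by (simp add: update_def cube_upd)
    have "{k \<in> {1..n}. ?y k} \<subset> {k \<in> {1..n}. x k}" using i v by (auto simp: upd)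
    then have card: "card {k \<in> {1..n}. ?y k} < card {k \<in> {1..n}. x k}"
      by (intro psubset_card_mono) auto
    have "\<forall>k\<in>{1..n}. ?y k \<le> x k" by (auto simp: upd)
    then have "\<forall>k\<in>{1..n}. f ?y k \<le> f x k"
      using mono y less.prems(1) by (auto simp only: monotone_network_def)
    then have "\<forall>k\<in>{1..n}. f ?y k \<le> ?y k" using less.prems(2) v by (auto simp: upd)
    from less.hyps[OF card y this] obtain w where "w \<in> lists {1..n}"
      "f (update_word f w ?y) = update_word f w ?y" by blast
    then show ?thesis using i(1) by (intro bexI[of _ "i # w"]) auto
  qed
qed

text \<open>Raise components that \<open>f\<close> wants true until none is left; the number of
  false components decreases.\<close>

lemma network_ascends:
  assumes "x \<in> cube n"
  shows "\<exists>w\<in>lists {1..n}. \<forall>i\<in>{1..n}. f (update_word f w x) i \<le> update_word f w x i"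
  using assms
proof (induction "card {i \<in> {1..n}. \<not> x i}" arbitrary: x rule: less_induct)
  case less
  show ?case
  proof (cases "\<forall>i\<in>{1..n}. f x i \<le> x i")
    case True
    then show ?thesis by (intro bexI[of _ "[]"]) auto
  next
    case False
    then obtain i where i: "i \<in> {1..n}" "f x i" "\<not> x i" by auto
    let ?y = "update f i x"
    have y: "?y \<in> cube n" using less.prems i(1) by (simp add: update_def cube_upd)
    have "{k \<in> {1..n}. \<not> ?y k} \<subset> {k \<in> {1..n}. \<not> x k}" using i by (auto simp: update_def)
    then have card: "card {k \<in> {1..n}. \<not> ?y k} < card {k \<in> {1..n}. \<not> x k}"
      by (intro psubset_card_mono) auto
    from less.hyps[OF card y] obtain w where "w \<in> lists {1..n}"
      "\<forall>i\<in>{1..n}. f (update_word f w ?y) i \<le> update_word f w ?y i" by blast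
    then show ?thesis using i(1) by (intro bexI[of _ "i # w"]) auto
  qed
qed

lemma monotone_reaches_fixed_point:
  assumes "monotone_network n f" "x \<in> cube n"
  shows "\<exists>w\<in>lists {1..n}. f (update_word f w x) = update_word f w x"
proof -
  obtain u where u: "u \<in> lists {1..n}"
    "\<forall>i\<in>{1..n}. f (update_word f u x) i \<le> update_word f u x i"
    using network_ascends[OF assms(2)] by blast
  obtain v where "v \<in> lists {1..n}"
    "f (update_word f v (update_word f u x)) = update_word f v (update_word f u x)"
    using monotone_descends[OF assms(1) update_word_cube[OF u(1) assms(2)] u(2)] by blast
  then show ?thesis using u(1) by (intro bexI[of _ "u @ v"]) auto
qed

text \<open>The pairs are treated one after another. The word appended for a new pair leaves the
  earlier ones alone, since they already sit at fixed points.\<close>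

lemma common_fixing_word:
  assumes "finite S"
    and "\<And>f x. (f, x) \<in> S \<Longrightarrow> x \<in> cube n \<and>
      (\<forall>y\<in>cube n. \<exists>w\<in>lists {1..n}. f (update_word f w y) = update_word f w y)"
  shows "\<exists>w\<in>lists {1..n}. \<forall>(f, x)\<in>S. f (update_word f w x) = update_word f w x"
  using assms
proof (induction S)
  case empty
  show ?case by (intro bexI[of _ "[]"]) auto
next
  case (insert p S)
  obtain f x where p: "p = (f, x)" by (cases p)
  obtain w where w: "w \<in> lists {1..n}" "\<forall>(f, x)\<in>S. f (update_word f w x) = update_word f w x"
    using insert.IH insert.prems by blast
  have "x \<in> cube n" using insert.prems p by blast
  then have "update_word f w x \<in> cube n" using w(1) by (rule update_word_cube[rotated])
  then obtain v where v: "v \<in> lists {1..n}"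
    "f (update_word f v (update_word f w x)) = update_word f v (update_word f w x)"
    using insert.prems p by blast
  have "\<forall>(f, x)\<in>insert p S. f (update_word f (w @ v) x) = update_word f (w @ v) x"
    using v(2) w(2) p by (auto simp: update_word_fixed)
  then show ?case using w(1) v(1) by (intro bexI[of _ "w @ v"]) auto
qed

lemma update_word_restrict:
  assumes "x \<in> cube n" "w \<in> lists {1..n}"
  shows "update_word (restrict f (cube n)) w x = update_word f w x"
  using assms
  by (induction w arbitrary: x) (auto simp: update_def cube_upd)

text \<open>A network is an arbitrary function off the cube, so finiteness needs the restrictions.\<close>

lemma monotone_fixing_word_exists: "\<exists>w. fixes_all n monotone_network w"
proof -
  let ?F = "{f \<in> cube n \<rightarrow>\<^sub>E cube n. monotone_network n f}"
  have "finite (?F \<times> cube n)"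
    by (simp add: finite_cube finite_PiE)
  then have "\<exists>w\<in>lists {1..n}. \<forall>(f, x)\<in>?F \<times> cube n. f (update_word f w x) = update_word f w x"
    by (rule common_fixing_word) (use monotone_reaches_fixed_point in blast)
  then obtain w where w: "w \<in> lists {1..n}"
    and fix_w: "\<And>f x. f \<in> ?F \<Longrightarrow> x \<in> cube n \<Longrightarrow> f (update_word f w x) = update_word f w x"
    by blast
  have "word_fixes n w f" if f: "monotone_network n f" for f
    unfolding word_fixes_def
  proof
    fix x assume x: "x \<in> cube n"
    have "restrict f (cube n) \<in> ?F"
      using f by (auto simp: monotone_network_def is_network_def)
    from fix_w[OF this x] show "f (update_word f w x) = update_word f w x"
      using update_word_restrict[OF x w, of f] update_word_cube[OF w x] by simp
  qed
  then show ?thesis using w by (auto simp: fixes_all_def)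
qed

section \<open>Comparison of the minimal lengths\<close>

text \<open>Every arc of a monotone network has sign 1, hence so does every cycle.\<close>

lemma monotone_imp_balanced:
  assumes "monotone_network n f"
  shows "balanced_network n f"
proof -
  have sign: "arc_sign n f e = 1" if e: "e \<in> arcs_of n f" for e
  proof -
    obtain j i where ji: "e = (j, i)" by (cases e)
    have "j \<in> {1..n}" "i \<in> {1..n}" using e ji arcs_of_verts by auto
    then have "f x i \<le> f (x(j := True)) i" if "x \<in> cube n" for x
    proof -
      have "\<forall>k\<in>{1..n}. x k \<le> (x(j := True)) k" by auto
      then show ?thesis
        using assms that \<open>j \<in> {1..n}\<close> \<open>i \<in> {1..n}\<close> cube_upd unfolding monotone_network_def by blast
    qed
    then show ?thesis by (simp add: ji arc_sign_def)
  qed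
  have "prod_list (map (arc_sign n f) c) = 1"
    if "pre_digraph.cycle (with_proj (interaction_graph n f)) c" for c
  proof -
    have "set c \<subseteq> arcs_of n f"
      using that by (auto simp: pre_digraph.cycle_def pre_digraph.awalk_def)
    then have "map (arc_sign n f) c = map (\<lambda>_. 1) c" using sign by (intro map_cong) auto
    then show ?thesis by (induction c) auto
  qed
  then show ?thesis using assms by (auto simp: balanced_network_def monotone_network_def)
qed

lemma min_fixing_length_le: "fixes_all n P w \<Longrightarrow> min_fixing_length P n \<le> length w"
  unfolding min_fixing_length_def by (rule Least_le) blast

lemma min_fixing_length_attained:
  assumes "fixes_all n P w"
  obtains u where "fixes_all n P u" "length u = min_fixing_length P n"
proof -
  have "\<exists>u. fixes_all n P u \<and> length u = (LEAST k. \<exists>u. fixes_all n P u \<and> length u = k)"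
    using assms by (intro LeastI_ex[of "\<lambda>k. \<exists>u. fixes_all n P u \<and> length u = k"]) blast
  then show ?thesis using that unfolding min_fixing_length_def by blast
qed

lemma length_word_power: "length (word_power k u) = k * length u"
  by (induction k) (auto simp: word_power_def)

lemma word_power_lists: "u \<in> lists A \<Longrightarrow> word_power k u \<in> lists A"
  by (induction k) (auto simp: word_power_def)

lemma length_word_tilde:
  "length (word_tilde n q r W) = q * (2 * n + length W) + r * n"
  by (simp add: word_tilde_def length_word_power word_s_def del: upt_Suc)

theorem theorem14:
  fixes n q r :: nat
  assumes "n \<ge> 1" and "n = 3 * q + r" and "r < 3"
  shows "(\<forall>W. fixes_all n monotone_network W \<and>
              (\<forall>V. fixes_all n monotone_network V \<longrightarrow> length W \<le> length V) \<longrightarrow>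
              (\<forall>f. balanced_network n f \<longrightarrow> word_fixes n (word_tilde n q r W) f)) \<and>
         lambda_M n \<le> lambda_B n \<and>
         real (lambda_B n) \<le> real n / 3 * real (lambda_M n) + (real n)\<^sup>2"
proof -
  have tilde: "word_fixes n (word_tilde n q r W) f"
    if "fixes_all n monotone_network W" "balanced_network n f" for W f
    using word_tilde_fixes[OF assms(2,3) that] .
  obtain W where W: "fixes_all n monotone_network W" "length W = lambda_M n"
    unfolding lambda_M_def using monotone_fixing_word_exists min_fixing_length_attained by metis
  have "word_tilde n q r W \<in> lists {1..n}"
    unfolding word_tilde_def
    using W(1) word_s_lists[of n] word_power_lists[of _ "{1..n}"] by (simp add: fixes_all_def)
  then have B: "fixes_all n balanced_network (word_tilde n q r W)"
    using tilde[OF W(1)] by (simp add: fixes_all_def)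
  obtain V where V: "fixes_all n balanced_network V" "length V = lambda_B n"
    unfolding lambda_B_def using min_fixing_length_attained[OF B] by metis
  have "fixes_all n monotone_network V"
    using V(1) monotone_imp_balanced by (simp add: fixes_all_def)
  then have le: "lambda_M n \<le> lambda_B n"
    using min_fixing_length_le V(2) unfolding lambda_M_def by metis
  have "lambda_B n \<le> q * (2 * n + lambda_M n) + r * n"
    using min_fixing_length_le[OF B] by (simp add: lambda_B_def length_word_tilde W(2))
  \<comment> \<open>The copies of \<open>s\<close> contribute \<open>(2 * q + r) * n\<close>, at
    most \<open>n * n\<close> because \<open>n = 3 * q + r\<close>.\<close>
  also have "\<dots> \<le> q * lambda_M n + n * n"
    unfolding assms(2) by (simp add: algebra_simps)
  finally have "real (lambda_B n) \<le> real (q * lambda_M n + n * n)" by (rule of_nat_mono)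
  also have "\<dots> = real q * real (lambda_M n) + (real n)\<^sup>2" by (simp add: power2_eq_square)
  also have "\<dots> \<le> real n / 3 * real (lambda_M n) + (real n)\<^sup>2"
    using assms(2) by (intro add_right_mono mult_right_mono) auto
  finally show ?thesis using tilde le by blast
qed

end
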